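(* Let $G=(V,E)$ be a connected graph with $V=\{1,\dots,N\}$ and at least one edge. Then the approximation ratio of the modified tree-reweighted method $\mathrm{TRW}'$ (defined in the context) satisfies $$\alpha(G,\mathrm{TRW}')\le \frac{1}{\sqrt{\kappa(G)}},\qquad \text{where}\quad \kappa(G)=\min_{S\subset V,\ E(S)\neq\emptyset}\frac{|S|-1}{|E(S)|},$$ and $E(S)=E\cap(S\times S)$ is the set of edges with both endpoints in $S$.
   Context: Problem: a finite alphabet $\mathcal{X}$, for each edge $e=(s,t)\in E$ an edge potential $\phi_e:\mathcal{X}\times\mathcal{X}\to\mathbb{R}_+$ (non-negative), and weights $\theta=(\theta_e)_{e\in E}\in\mathbb{R}_+^{E}$. The log-partition function is $\Phi(\theta)=\log\sum_{x\in\mathcal{X}^N}\exp\big(\sum_{e\in E}\theta_e\phi_e(x_e)\big)$, where $x_e=(x_s,x_t)$. For an algorithm ALG producing an estimate $\widehat\Phi^{\mathrm{ALG}}(\theta)$ from $(G,\mathcal{X},(\phi_e),\theta)$, its approximation ratio on $G$ is $\alpha(G,\mathrm{ALG})=\sup\max\big(\Phi(\theta)/\widehat\Phi^{\mathrm{ALG}}(\theta),\ \widehat\Phi^{\mathrm{ALG}}(\theta)/\Phi(\theta)\big)$, the supremum over all such $\mathcal{X},(\phi_e),\theta$. Let $\mathcal{T}(G)$ be the set of spanning trees of $G$ (identified with their edge sets) and $\mathcal{P}(\mathcal{T}(G))$ the set of probability distributions $\rho=(\rho^T)_{T\in\mathcal{T}(G)}$ on it; set $\rho_e=\sum_{T}\rho^T\mathbf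 1(e\in T)$ and $\kappa(G,\rho)=\min_{e\in E}\rho_e$. For a spanning tree $T$ define $\Pi^T(\theta)=(\mathbf 1(e\in T)\theta_e)_{e\in E}$ and $\Pi^T_\rho(\theta)=(\mathbf 1(e\in T)\theta_e/\rho_e)_{e\in E}$. Let $L_\rho(\theta)=\sum_T\rho^T\Phi(\Pi^T(\theta))$, $U_\rho(\theta)=\sum_T\rho^T\Phi(\Pi^T_\rho(\theta))$ and $\widehat\Phi_\rho(\theta)=\sqrt{L_\rho(\theta)U_\rho(\theta)}$. The method $\mathrm{TRW}'$ outputs $\widehat\Phi_{\rho^\star}(\theta)$ where $\rho^\star\in\arg\max_{\rho\in\mathcal{P}(\mathcal{T}(G))}\kappa(G,\rho)$. *)

theory Defs
  imports
    "HOL-Probability.Probability_Mass_Function"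
    "Graph_Theory.Digraph_Component"
begin

text \<open>
  A simple undirected graph is given by listing each edge once, as an ordered pair: a digraph
  without loops and without antiparallel arcs. The orientation only serves to tell
  apart the two arguments of an edge potential, which need not be symmetric.
\<close>

definition simple_graph :: "'v pair_pre_digraph \<Rightarrow> bool" where
  "simple_graph G \<longleftrightarrow> pair_digraph G \<and> antisym (parcs G)"

text \<open>
  Cycles are taken in the underlying undirected graph, where the closed walks of length 2 that
  traverse one edge back and forth do not count. (The constants \<open>forest\<close> and \<open>spanning_tree\<close> of
  \<^theory>\<open>Graph_Theory.Digraph_Component\<close> refer to directed cycles and are not the right notions
  here.)
\<close>

definition undirected_acyclic :: "'v pair_pre_digraph \<Rightarrow> bool" where
  "undirected_acyclic G \<longleftrightarrow>
     \<not> (\<exists>p. pre_digraph.cycle (with_proj (mk_symmetric (with_proj G))) p \<and> length p \<ge> 3)"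

definition spanning_trees :: "'v pair_pre_digraph \<Rightarrow> ('v \<times> 'v) set set" where
  "spanning_trees G =
     {T. T \<subseteq> parcs G \<and>
         Digraph_Component.connected (with_proj \<lparr>pverts = pverts G, parcs = T\<rparr>) \<and>
         undirected_acyclic \<lparr>pverts = pverts G, parcs = T\<rparr>}"

definition edges_within :: "'v pair_pre_digraph \<Rightarrow> 'v set \<Rightarrow> ('v \<times> 'v) set" where
  "edges_within G S = parcs G \<inter> (S \<times> S)"

definition graph_kappa :: "'v pair_pre_digraph \<Rightarrow> real" where
  "graph_kappa G =
     Min ((\<lambda>S. (real (card S) - 1) / real (card (edges_within G S))) `
          {S. S \<subseteq> pverts G \<and> edges_within G S \<noteq> {}})"


type_synonym ('v, 'x) potentials = "'v \<times> 'v \<Rightarrow> 'x \<times> 'x \<Rightarrow> real"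
type_synonym 'v weights = "'v \<times> 'v \<Rightarrow> real"

definition log_partition ::
  "'v pair_pre_digraph \<Rightarrow> 'x set \<Rightarrow> ('v, 'x) potentials \<Rightarrow> 'v weights \<Rightarrow> real" where
  "log_partition G X \<phi> \<theta> =
     ln (\<Sum>x \<in> pverts G \<rightarrow>\<^sub>E X. exp (\<Sum>e\<in>parcs G. \<theta> e * \<phi> e (x (fst e), x (snd e))))"

definition model_instances ::
  "'v pair_pre_digraph \<Rightarrow> ('x set \<times> ('v, 'x) potentials \<times> 'v weights) set" where
  "model_instances G =
     {(X, \<phi>, \<theta>). finite X \<and> X \<noteq> {} \<and>
        (\<forall>e\<in>parcs G. \<forall>y\<in>X \<times> X. \<phi> e y \<ge> 0) \<and> (\<forall>e\<in>parcs G. \<theta> e \<ge> 0)}"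

text \<open>
  An estimator of the log-partition function. Alphabets are finite sets over an arbitrary type
  \<open>'x\<close>; every finite alphabet occurs, up to renaming of its letters, over any infinite \<open>'x\<close>.
\<close>

type_synonym ('v, 'x) estimator =
  "'v pair_pre_digraph \<Rightarrow> 'x set \<Rightarrow> ('v, 'x) potentials \<Rightarrow> 'v weights \<Rightarrow> real"

text \<open>
  Quotients are extended reals, so that \<open>a / 0 = \<infinity>\<close> for \<open>a > 0\<close>. An exact estimate \<open>0\<close> of \<open>0\<close>
  (possible for a one-letter alphabet) has ratio \<open>1\<close>.
\<close>

definition ratio :: "real \<Rightarrow> real \<Rightarrow> ereal" where
  "ratio a b = (if a = 0 \<and> b = 0 then 1 else ereal a / ereal b)"

definition approx_ratio :: "'v pair_pre_digraph \<Rightarrow> ('v, 'x) estimator \<Rightarrow> ereal" where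
  "approx_ratio G ALG =
     (SUP (X, \<phi>, \<theta>) \<in> model_instances G.
        max (ratio (log_partition G X \<phi> \<theta>) (ALG G X \<phi> \<theta>))
            (ratio (ALG G X \<phi> \<theta>) (log_partition G X \<phi> \<theta>)))"


definition tree_dists :: "'v pair_pre_digraph \<Rightarrow> ('v \<times> 'v) set pmf set" where
  "tree_dists G = {\<rho>. set_pmf \<rho> \<subseteq> spanning_trees G}"

definition edge_prob :: "'v pair_pre_digraph \<Rightarrow> ('v \<times> 'v) set pmf \<Rightarrow> 'v \<times> 'v \<Rightarrow> real" where
  "edge_prob G \<rho> e = (\<Sum>T\<in>spanning_trees G. pmf \<rho> T * of_bool (e \<in> T))"

definition dist_kappa :: "'v pair_pre_digraph \<Rightarrow> ('v \<times> 'v) set pmf \<Rightarrow> real" where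
  "dist_kappa G \<rho> = Min (edge_prob G \<rho> ` parcs G)"

definition optimal_tree_dists :: "'v pair_pre_digraph \<Rightarrow> ('v \<times> 'v) set pmf set" where
  "optimal_tree_dists G = {\<rho>. is_arg_max (dist_kappa G) (\<lambda>\<rho>. \<rho> \<in> tree_dists G) \<rho>}"

definition tree_weights :: "('v \<times> 'v) set \<Rightarrow> 'v weights \<Rightarrow> 'v weights" where
  "tree_weights T \<theta> = (\<lambda>e. of_bool (e \<in> T) * \<theta> e)"

text \<open>
  Division by \<open>edge_prob G \<rho> e = 0\<close> only concerns trees of probability \<open>0\<close>, which do not
  contribute to \<open>trw_upper\<close> below.
\<close>

definition scaled_tree_weights ::
  "'v pair_pre_digraph \<Rightarrow> ('v \<times> 'v) set pmf \<Rightarrow> ('v \<times> 'v) set \<Rightarrow> 'v weights \<Rightarrow> 'v weights" where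
  "scaled_tree_weights G \<rho> T \<theta> = (\<lambda>e. of_bool (e \<in> T) * \<theta> e / edge_prob G \<rho> e)"

definition trw_lower :: "('v \<times> 'v) set pmf \<Rightarrow> ('v, 'x) estimator" where
  "trw_lower \<rho> G X \<phi> \<theta> =
     (\<Sum>T\<in>spanning_trees G. pmf \<rho> T * log_partition G X \<phi> (tree_weights T \<theta>))"

definition trw_upper :: "('v \<times> 'v) set pmf \<Rightarrow> ('v, 'x) estimator" where
  "trw_upper \<rho> G X \<phi> \<theta> =
     (\<Sum>T\<in>spanning_trees G. pmf \<rho> T * log_partition G X \<phi> (scaled_tree_weights G \<rho> T \<theta>))"

definition trw_estimate :: "('v \<times> 'v) set pmf \<Rightarrow> ('v, 'x) estimator" where
  "trw_estimate \<rho> G X \<phi> \<theta> = sqrt (trw_lower \<rho> G X \<phi> \<theta> * trw_upper \<rho> G X \<phi> \<theta>)"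

end

theory Submission
  imports Defs
begin

text \<open>
  Among the tree distributions maximising the minimal edge probability \<open>m\<close>, take one with the fewest
  tight edges (edges of probability \<open>m\<close>), and let \<open>M\<close> be the set of its tight edges. If some tree \<open>T\<close>
  of the support did not link the endpoints of an edge \<open>f \<in> M\<close> by a path inside \<open>T \<inter> M\<close>, a small
  amount of mass could be moved from \<open>T\<close> to \<open>T - {e} \<union> {f}\<close> with \<open>e \<notin> M\<close> on the fundamental cycle of
  \<open>f\<close>, which contradicts the choice. Hence \<open>T \<inter> M\<close> connects every component \<open>S\<close> of \<open>M\<close>, so it has
  at least \<open>\<Sum> (|S| - 1) \<ge> \<kappa>(G) |M|\<close> edges, and averaging over \<open>T\<close> gives \<open>m |M| \<ge> \<kappa>(G) |M|\<close>. This
  replaces the duality argument for the spanning tree polytope.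

  The log-partition function \<open>\<Phi>\<close> is monotone and convex, and \<open>c \<Phi>(\<theta>) \<le> \<Phi>(c \<theta>)\<close> for \<open>c \<in> [0, 1]\<close>;
  hence \<open>m U \<le> L \<le> \<Phi> \<le> U\<close>, which bounds \<open>sqrt (L U)\<close> from both sides.
\<close>

section \<open>Connectivity in undirected graphs\<close>

definition linked :: "('a \<times> 'a) set \<Rightarrow> ('a \<times> 'a) set" where
  "linked F = (F \<union> F\<inverse>)\<^sup>*"

text \<open>Acyclicity phrased without walks, so that exchange arguments reduce to computations with
  \<open>linked\<close>. Loops and antiparallel pairs also violate it.\<close>

definition all_bridges :: "('a \<times> 'a) set \<Rightarrow> bool" where
  "all_bridges F \<longleftrightarrow> (\<forall>(u, v)\<in>F. (u, v) \<notin> linked (F - {(u, v)}))"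

lemma linked_refl [simp]: "(x, x) \<in> linked F"
  by (simp add: linked_def)

lemma linked_sym: "(x, y) \<in> linked F \<Longrightarrow> (y, x) \<in> linked F"
proof -
  have "sym (linked F)"
    unfolding linked_def by (intro sym_rtrancl sym_Un_converse)
  then show "(x, y) \<in> linked F \<Longrightarrow> (y, x) \<in> linked F"
    by (rule symD)
qed

lemma linked_trans: "(x, y) \<in> linked F \<Longrightarrow> (y, z) \<in> linked F \<Longrightarrow> (x, z) \<in> linked F"
  unfolding linked_def by (rule rtrancl_trans)

text \<open>The hypothesis is what \<open>linked_insertD\<close> leaves once its first alternative
  is excluded: the pairs (x, y) and (a, b) sit opposite each other on a closed walk, so either can
  replace the other.\<close>

lemma linked_iff_if_ends_linked:
  assumes "(x, a) \<in> linked F \<and> (b, y) \<in> linked F \<or> (x, b) \<in> linked F \<and> (a, y) \<in> linked F"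
  shows "(x, y) \<in> linked F \<longleftrightarrow> (a, b) \<in> linked F"
  using assms
proof (elim disjE conjE)
  assume "(x, a) \<in> linked F" "(b, y) \<in> linked F"
  note this this[THEN linked_sym]
  then show ?thesis by (metis linked_trans)
next
  assume "(x, b) \<in> linked F" "(a, y) \<in> linked F"
  note this this[THEN linked_sym]
  then show ?thesis by (metis linked_trans linked_sym)
qed

lemma equiv_linked: "equiv UNIV (linked F)"
proof (rule equivI)
  show "sym (linked F)" by (rule symI) (rule linked_sym)
  show "trans (linked F)" by (rule transI) (rule linked_trans)
qed (auto intro: refl_onI)

lemma linked_edge: "(x, y) \<in> F \<union> F\<inverse> \<Longrightarrow> (x, y) \<in> linked F"
  unfolding linked_def by (rule r_into_rtrancl)

lemma subset_linked: "F \<subseteq> linked F"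
  by (auto simp: linked_def)

lemma linked_mono: "F \<subseteq> F' \<Longrightarrow> linked F \<subseteq> linked F'"
  unfolding linked_def by (intro rtrancl_mono) auto

lemma linked_least:
  assumes "M \<subseteq> linked F"
  shows "linked M \<subseteq> linked F"
proof -
  have "M \<union> M\<inverse> \<subseteq> linked F"
    using assms by (auto intro: linked_sym[OF subsetD[OF assms]])
  then have "(M \<union> M\<inverse>)\<^sup>* \<subseteq> (linked F)\<^sup>*"
    by (rule rtrancl_mono)
  then show ?thesis
    by (simp add: linked_def)
qed

text \<open>A walk needs the new edge at most once: a second traversal returns to a side already
  reached inside F. The induction along the walk carries the three alternatives.\<close>

lemma linked_insertD:
  assumes "(x, y) \<in> linked (insert (a, b) F)"
  shows "(x, y) \<in> linked F \<or> (x, a) \<in> linked F \<and> (b, y) \<in> linked F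
    \<or> (x, b) \<in> linked F \<and> (a, y) \<in> linked F"
  using assms unfolding linked_def[of "insert (a, b) F"]
proof (induction rule: rtrancl_induct)
  case base
  then show ?case by simp
next
  case (step y z)
  then have "(y, z) \<in> linked F \<or> (y = a \<and> z = b) \<or> (y = b \<and> z = a)"
    using linked_edge[of y z F] by blast
  then show ?case
  proof (elim disjE conjE)
    assume "(y, z) \<in> linked F"
    with step.IH show ?thesis using linked_trans[OF _ \<open>(y, z) \<in> linked F\<close>] by blast
  next
    assume "y = a" "z = b"
    with step.IH show ?thesis using linked_trans[of x a F b] linked_sym[of b a F] by auto
  next
    assume "y = b" "z = a"
    with step.IH show ?thesis using linked_trans[of x b F a] linked_sym[of a b F] by auto
  qed
qed

lemma linked_subset_Times:
  assumes "F \<subseteq> V \<times> V" "x \<in> V" "(x, y) \<in> linked F"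
  shows "y \<in> V"
  using assms(3) unfolding linked_def
  by (induction rule: rtrancl_induct) (use assms(1,2) in auto)

section \<open>Minimal linking sets and exchange of edges\<close>

lemma ex_minimal_linking:
  assumes "finite F" "Q \<subseteq> linked F"
  obtains P where "P \<subseteq> F" "Q \<subseteq> linked P" "\<And>e. e \<in> P \<Longrightarrow> \<not> Q \<subseteq> linked (P - {e})"
proof -
  obtain P where P: "P \<subseteq> F" "Q \<subseteq> linked P"
    and min: "\<And>P'. P' \<subseteq> F \<Longrightarrow> Q \<subseteq> linked P' \<Longrightarrow> card P \<le> card P'"
    using ex_has_least_nat[of "\<lambda>P. P \<subseteq> F \<and> Q \<subseteq> linked P" F card] assms(2) by auto
  have "finite P"
    using P(1) assms(1) by (rule finite_subset)
  have "\<not> Q \<subseteq> linked (P - {e})" if e: "e \<in> P" for e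
  proof
    assume "Q \<subseteq> linked (P - {e})"
    with P(1) have "card P \<le> card (P - {e})"
      by (intro min) auto
    with card_Diff1_less[OF \<open>finite P\<close> e] show False by simp
  qed
  with P show thesis by (rule that)
qed

text \<open>An edge whose endpoints stay linked without it can be deleted without changing
  \<open>linked\<close> at all, which contradicts minimality.\<close>

lemma all_bridges_minimal:
  assumes "\<And>e. e \<in> P \<Longrightarrow> \<not> Q \<subseteq> linked (P - {e})" "Q \<subseteq> linked P"
  shows "all_bridges P"
  unfolding all_bridges_def
proof clarify
  fix u v assume uv: "(u, v) \<in> P" "(u, v) \<in> linked (P - {(u, v)})"
  then have "linked P \<subseteq> linked (P - {(u, v)})"
    using subset_linked[of "P - {(u, v)}"] by (intro linked_least) blast
  with assms(2) have "Q \<subseteq> linked (P - {(u, v)})" by (rule subset_trans)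
  with assms(1)[OF uv(1)] show False by contradiction
qed

text \<open>An edge of a minimal subset of \<open>T\<close> linking \<open>a\<close> to \<open>b\<close> lies on the unique path from \<open>a\<close>
  to \<open>b\<close> in \<open>T\<close>.\<close>

lemma ex_cut_edge:
  assumes "finite T" "all_bridges T" "(a, b) \<in> linked T" "(a, b) \<notin> linked (T \<inter> M)"
  obtains e where "e \<in> T - M" "(a, b) \<notin> linked (T - {e})"
proof -
  obtain P where P: "P \<subseteq> T" "(a, b) \<in> linked P"
    and min: "\<And>e. e \<in> P \<Longrightarrow> (a, b) \<notin> linked (P - {e})"
    using ex_minimal_linking[of T "{(a, b)}"] assms(1,3) by auto
  have "\<not> P \<subseteq> T \<inter> M"
    using P(2) assms(4) linked_mono[of P "T \<inter> M"] by blast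
  then obtain u v where e: "(u, v) \<in> P" "(u, v) \<notin> M"
    using P(1) by auto
  let ?e = "(u, v)"
  have "(a, b) \<in> linked (insert ?e (P - {?e}))"
    using P(2) e(1) by (simp add: insert_absorb)
  from linked_insertD[OF this] have "(a, u) \<in> linked (P - {?e}) \<and> (v, b) \<in> linked (P - {?e})
      \<or> (a, v) \<in> linked (P - {?e}) \<and> (u, b) \<in> linked (P - {?e})"
    using min[OF e(1)] by simp
  moreover have "linked (P - {?e}) \<subseteq> linked (T - {?e})"
    using P(1) by (intro linked_mono) auto
  ultimately have "(a, u) \<in> linked (T - {?e}) \<and> (v, b) \<in> linked (T - {?e})
      \<or> (a, v) \<in> linked (T - {?e}) \<and> (u, b) \<in> linked (T - {?e})"
    by blast
  moreover have "(u, v) \<notin> linked (T - {?e})"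
    using assms(2) e(1) P(1) by (auto simp: all_bridges_def)
  \<comment> \<open>A link between a and b avoiding the edge would also link u and v, although (u,
    v) is a bridge of T.\<close>
  ultimately have "(a, b) \<notin> linked (T - {?e})"
    using linked_iff_if_ends_linked[of a u "T - {?e}" v b] by blast
  with e P(1) show thesis by (intro that[of ?e]) auto
qed

text \<open>Deleting e separates a from b, so the link in T passes through e; going round it through
  the new edge (a, b) links the ends of e again.\<close>

lemma linked_exchange:
  assumes "e \<in> T" "(a, b) \<in> linked T" "(a, b) \<notin> linked (T - {e})"
  shows "linked (insert (a, b) (T - {e})) = linked T"
proof
  show "linked (insert (a, b) (T - {e})) \<subseteq> linked T"
    using assms(2) subset_linked[of T] by (intro linked_least) blast
  obtain u v where e: "e = (u, v)" by fastforce
  let ?T' = "insert (a, b) (T - {e})"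
  have "(a, b) \<in> linked (insert (u, v) (T - {e}))"
    using assms(1,2) by (simp add: e insert_absorb)
  from linked_insertD[OF this] have "(a, u) \<in> linked (T - {e}) \<and> (v, b) \<in> linked (T - {e})
      \<or> (a, v) \<in> linked (T - {e}) \<and> (u, b) \<in> linked (T - {e})"
    using assms(3) by simp
  moreover have "linked (T - {e}) \<subseteq> linked ?T'"
    by (intro linked_mono) auto
  moreover have "(a, b) \<in> linked ?T'"
    by (rule linked_edge) simp
  ultimately have "(u, v) \<in> linked ?T'"
    using linked_iff_if_ends_linked[of a u ?T' v b] by blast
  then show "linked T \<subseteq> linked ?T'"
    using subset_linked[of ?T'] unfolding e by (intro linked_least) blast
qed

text \<open>A cycle through an old edge (x, y) must use (a, b), because (x, y) is a bridge of T. The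
  rest of that cycle together with (x, y) would link a to b in T - {e}.\<close>

lemma all_bridges_exchange:
  assumes "all_bridges T" "e \<in> T" "(a, b) \<notin> linked (T - {e})"
  shows "all_bridges (insert (a, b) (T - {e}))"
proof -
  have nab: "(a, b) \<notin> T - {e}"
    using assms(3) subset_linked[of "T - {e}"] by blast
  have "(x, y) \<notin> linked (insert (a, b) (T - {e}) - {(x, y)})"
    if xy: "(x, y) \<in> T - {e}" for x y
  proof
    let ?F = "T - {e} - {(x, y)}"
    assume "(x, y) \<in> linked (insert (a, b) (T - {e}) - {(x, y)})"
    moreover have "insert (a, b) (T - {e}) - {(x, y)} = insert (a, b) ?F"
      using nab xy by auto
    ultimately have "(x, y) \<in> linked (insert (a, b) ?F)" by simp
    moreover have "linked ?F \<subseteq> linked (T - {(x, y)})"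
      by (intro linked_mono) auto
    moreover have "(x, y) \<notin> linked (T - {(x, y)})"
      using assms(1) xy by (auto simp: all_bridges_def)
    ultimately have "(x, a) \<in> linked ?F \<and> (b, y) \<in> linked ?F
        \<or> (x, b) \<in> linked ?F \<and> (a, y) \<in> linked ?F"
      using linked_insertD[of x y a b ?F] by blast
    moreover have "linked ?F \<subseteq> linked (T - {e})"
      by (intro linked_mono) auto
    moreover have "(x, y) \<in> linked (T - {e})"
      using xy by (intro linked_edge) simp
    ultimately have "(a, b) \<in> linked (T - {e})"
      using linked_iff_if_ends_linked[of x a "T - {e}" b y] by blast
    with assms(3) show False by simp
  qed
  moreover have "(a, b) \<notin> linked (insert (a, b) (T - {e}) - {(a, b)})"
    using assms(3) nab by simp
  ultimately show ?thesis
    unfolding all_bridges_def by auto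
qed

text \<open>A vertex set is grown from a root r inside S: every new vertex brings at least one new
  edge, and growth stops only at S itself.\<close>

lemma card_component_le:
  assumes "finite F" "finite S" "S \<noteq> {}" "\<And>x y. x \<in> S \<Longrightarrow> y \<in> S \<Longrightarrow> (x, y) \<in> linked F"
    and closed: "\<And>x y. x \<in> S \<Longrightarrow> (x, y) \<in> linked F \<Longrightarrow> y \<in> S"
  shows "card S \<le> card (F \<inter> S \<times> S) + 1"
proof -
  obtain r where r: "r \<in> S" using assms(3) by blast
  define P where "P A \<longleftrightarrow> A \<subseteq> S \<and> r \<in> A \<and> card A \<le> card (F \<inter> A \<times> A) + 1" for A
  have "P {r}" using r by (simp add: P_def)
  moreover have "\<forall>A. P A \<longrightarrow> card A < card S + 1"
    using card_mono[OF assms(2)] by (auto simp: P_def less_Suc_eq_le)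
  ultimately obtain A where A: "P A" and max: "\<And>B. P B \<Longrightarrow> card B \<le> card A"
    using ex_has_greatest_nat[of P "{r}" card "card S + 1"] by (metis)
  have finA: "finite A" using A assms(2) finite_subset by (auto simp: P_def)
  have closedA: "y \<in> A" if "x \<in> A" "(x, y) \<in> F \<union> F\<inverse>" for x y
  proof (rule ccontr)
    assume y: "y \<notin> A"
    have "x \<in> S" using A that(1) by (auto simp: P_def)
    moreover have "(x, y) \<in> linked F"
      using that(2) by (rule linked_edge)
    ultimately have "y \<in> S" by (rule closed)
    \<comment> \<open>The edge between x and y, in whichever orientation F contains it, is
      gained.\<close>
    have "F \<inter> A \<times> A \<subset> F \<inter> insert y A \<times> insert y A"
      using that y by auto
    then have "card (F \<inter> A \<times> A) < card (F \<inter> insert y A \<times> insert y A)"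
      using assms(1) by (intro psubset_card_mono) auto
    then have "P (insert y A)"
      using A \<open>y \<in> S\<close> y finA by (simp add: P_def)
    with max[of "insert y A"] y finA show False by simp
  qed
  have "S \<subseteq> A"
  proof
    fix s assume "s \<in> S"
    then have "(r, s) \<in> (F \<union> F\<inverse>)\<^sup>*"
      using assms(4) r by (simp add: linked_def)
    then show "s \<in> A"
      by (induction rule: rtrancl_induct) (use A closedA in \<open>auto simp: P_def\<close>)
  qed
  then have "A = S" using A by (auto simp: P_def)
  then show ?thesis using A by (simp add: P_def)
qed

text \<open>The vertices split into the classes of \<open>linked F\<close>. Since M lies in
  \<open>linked F\<close>, no edge of M or F runs between classes, so both cardinalities are sums
  over classes, compared by \<open>sparse\<close> and \<open>card_component_le\<close>.\<close>

lemma card_linking_set_ge: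
  fixes \<kappa> :: real
  assumes "finite V" "F \<subseteq> V \<times> V" "M \<subseteq> V \<times> V" "M \<subseteq> linked F"
    and sparse: "\<And>S. S \<subseteq> V \<Longrightarrow> S \<noteq> {} \<Longrightarrow> \<kappa> * card (M \<inter> S \<times> S) \<le> real (card S) - 1"
  shows "\<kappa> * card M \<le> card F"
proof -
  define C where "C = (\<lambda>r. linked F `` {r}) ` V"
  have fin: "finite (V \<times> V)" "finite C"
    using assms(1) by (simp_all add: C_def)
  have disj: "S \<inter> S' = {}" if SS': "S \<in> C" "S' \<in> C" "S \<noteq> S'" for S S'
  proof (rule ccontr)
    assume "S \<inter> S' \<noteq> {}"
    moreover obtain r r' where r: "S = linked F `` {r}" "S' = linked F `` {r'}"
      using SS'(1,2) by (auto simp: C_def)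
    ultimately have "S = S'"
      using quotient_disj[OF equiv_linked[of F], of S S'] by (auto simp: quotient_def)
    with SS'(3) show False ..
  qed
  have card_split: "card H = (\<Sum>S\<in>C. card (H \<inter> S \<times> S))"
    if H: "H \<subseteq> V \<times> V" "H \<subseteq> linked F" for H
  proof -
    have "finite H" using H(1) fin(1) by (rule finite_subset)
    moreover have "H \<subseteq> (\<Union>S\<in>C. H \<inter> S \<times> S)"
    proof clarify
      fix x y assume xy: "(x, y) \<in> H"
      then have "x \<in> V" "(x, y) \<in> linked F" using H by auto
      then show "(x, y) \<in> (\<Union>S\<in>C. H \<inter> S \<times> S)"
        using xy by (auto simp: C_def intro!: bexI[of _ x])
    qed
    then have "H = (\<Union>S\<in>C. H \<inter> S \<times> S)" by blast
    moreover have "card (\<Union>S\<in>C. H \<inter> S \<times> S) = (\<Sum>S\<in>C. card (H \<inter> S \<times> S))"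
      using fin(2) \<open>finite H\<close> disj by (intro card_UN_disjoint) fast+
    ultimately show ?thesis by simp
  qed
  have "\<kappa> * card (M \<inter> S \<times> S) \<le> card (F \<inter> S \<times> S)" if S: "S \<in> C" for S
  proof -
    obtain r where r: "r \<in> V" "S = linked F `` {r}"
      using S by (auto simp: C_def)
    have sub: "S \<subseteq> V"
      using r linked_subset_Times[OF assms(2) r(1)] by blast
    have "r \<in> S" using r by simp
    then have ne: "S \<noteq> {}" by blast
    have "card S \<le> card (F \<inter> S \<times> S) + 1"
    proof (rule card_component_le)
      show "finite F" using assms(2) fin(1) by (rule finite_subset)
      show "finite S" using sub assms(1) by (rule finite_subset)
      show "(x, y) \<in> linked F" if "x \<in> S" "y \<in> S" for x y
        using linked_trans[OF linked_sym, of r x F y] that by (simp add: r(2))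
      show "y \<in> S" if "x \<in> S" "(x, y) \<in> linked F" for x y
        using linked_trans[of r x F y] that by (simp add: r(2))
    qed (fact ne)
    with sparse[OF sub ne] show ?thesis by linarith
  qed
  then have "(\<Sum>S\<in>C. \<kappa> * card (M \<inter> S \<times> S)) \<le> (\<Sum>S\<in>C. real (card (F \<inter> S \<times> S)))"
    by (rule sum_mono)
  then show ?thesis
    using card_split[OF assms(3,4)] card_split[OF assms(2) subset_linked]
    by (simp add: sum_distrib_left)
qed

section \<open>Spanning trees as minimal connecting edge sets\<close>

lemma pcas_in_rtrancl: "pcas y q u \<Longrightarrow> set q \<subseteq> A \<Longrightarrow> (y, u) \<in> A\<^sup>*"
  by (induction y q u rule: pcas.induct) (auto intro: converse_rtrancl_into_rtrancl)

lemma pcas_end_in_pawalk_verts: "pcas y q u \<Longrightarrow> u \<in> set (pawalk_verts y q)"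
  by (induction y q u rule: pcas.induct) auto

lemma pcas_tail_in_pawalk_verts: "pcas y q u \<Longrightarrow> (a, b) \<in> set q \<Longrightarrow> a \<in> set (pawalk_verts y q)"
  by (induction y q u rule: pcas.induct) auto

lemma no_arc_from_end_of_path:
  "pcas y q u \<Longrightarrow> distinct (pawalk_verts y q) \<Longrightarrow> (u, b) \<notin> set q"
proof (induction y q u rule: pcas.induct)
  case (2 y e es u)
  then show ?case
    using pcas_end_in_pawalk_verts[of "snd e" es u] by auto
qed auto

text \<open>Only the first arc leaves y; were it (y, u), the path would end after one arc. With
  \<open>no_arc_from_end_of_path\<close> this shows that a cycle of length at least 3 traverses its
  first edge just once, in either direction.\<close>

lemma no_arc_start_to_end_of_path:
  assumes "pcas y q u" "distinct (pawalk_verts y q)" "length q \<ge> 2"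
  shows "(y, u) \<notin> set q"
proof
  assume yu: "(y, u) \<in> set q"
  obtain z r where q: "q = (y, z) # r" and r: "pcas z r u" "y \<notin> set (pawalk_verts z r)"
      "distinct (pawalk_verts z r)"
    using assms(1,2,3) by (cases q) auto
  then have "z = u"
    using yu pcas_tail_in_pawalk_verts[of z r u y u] by auto
  with r assms(3) q show False
    by (cases r) (auto dest: pcas_end_in_pawalk_verts)
qed

context
  fixes V :: "'v set" and T :: "('v \<times> 'v) set"
  assumes fin: "finite V" and T_sub: "T \<subseteq> V \<times> V"
begin

abbreviation "sym_graph \<equiv> mk_symmetric (with_proj \<lparr>pverts = V, parcs = T\<rparr>)"

lemma parcs_sym_graph: "parcs sym_graph = T \<union> T\<inverse>"
  by (auto simp: parcs_mk_symmetric)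

text \<open>\<open>reachable\<close> is reflexive only on V, \<open>linked\<close> on the whole
  type; a start in V removes the difference.\<close>

lemma reachable_sym_graph_iff:
  assumes "x \<in> V"
  shows "reachable (with_proj sym_graph) x y \<longleftrightarrow> (x, y) \<in> linked T"
proof
  assume "(x, y) \<in> linked T"
  then have "y \<in> V" using linked_subset_Times[OF T_sub assms] by blast
  with \<open>(x, y) \<in> linked T\<close> assms show "reachable (with_proj sym_graph) x y"
    unfolding reachable_def linked_def with_proj_simps parcs_sym_graph
    by (intro rtrancl_consistent_rtrancl_on) (use T_sub in auto)
next
  assume "reachable (with_proj sym_graph) x y"
  then show "(x, y) \<in> linked T"
    unfolding reachable_def linked_def with_proj_simps parcs_sym_graph
    by (rule rtrancl_on_rtranclI)
qed

lemma connected_iff_linked: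
  "Digraph_Component.connected (with_proj \<lparr>pverts = V, parcs = T\<rparr>)
     \<longleftrightarrow> V \<noteq> {} \<and> V \<times> V \<subseteq> linked T"
  by (auto simp: connected_def strongly_connected_def reachable_sym_graph_iff)

lemma undirected_acyclic_if_all_bridges:
  assumes br: "all_bridges T"
  shows "undirected_acyclic \<lparr>pverts = V, parcs = T\<rparr>"
  unfolding undirected_acyclic_def
proof clarify
  interpret S: pair_pre_digraph sym_graph .
  fix p assume p: "S.cycle p" "length p \<ge> 3"
  then obtain u where u: "S.awalk u p u" "distinct (tl (pawalk_verts u p))"
    by (auto simp: S.cycle_def)
  then obtain y q where pq: "p = (u, y) # q"
    using p(2) by (cases p) (auto simp: S.awalk_def)
  then have q: "pcas y q u" "set q \<subseteq> T \<union> T\<inverse>" "(u, y) \<in> T \<union> T\<inverse>"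
      "distinct (pawalk_verts y q)" "length q \<ge> 2"
    using u p(2) by (auto simp: S.awalk_def parcs_sym_graph)
  have "(u, y) \<notin> set q" "(y, u) \<notin> set q"
    using no_arc_from_end_of_path[OF q(1,4)] no_arc_start_to_end_of_path[OF q(1,4,5)] by auto
  \<comment> \<open>T may store the first edge of the cycle in either orientation, so both deletions
    are treated.\<close>
  then have "(y, u) \<in> linked (T - {(u, y)})" "(y, u) \<in> linked (T - {(y, u)})"
    unfolding linked_def using q(2) by (auto intro!: pcas_in_rtrancl[OF q(1)])
  with q(3) br linked_sym[of y u "T - {(u, y)}"] show False
    by (auto simp: all_bridges_def)
qed

end

text \<open>A path from v to u avoiding (u, v) closes up to a cycle. Irreflexivity and antisymmetry
  rule out paths of length 0 and 1, so the cycle has length at least 3 and is not just one edge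
  traversed back and forth.\<close>

lemma all_bridges_if_undirected_acyclic:
  assumes "finite V" "T \<subseteq> V \<times> V" "antisym T" "irrefl T"
    and acyclic: "undirected_acyclic \<lparr>pverts = V, parcs = T\<rparr>"
  shows "all_bridges T"
  unfolding all_bridges_def
proof clarify
  fix u v assume uv: "(u, v) \<in> T" "(u, v) \<in> linked (T - {(u, v)})"
  let ?T' = "T - {(u, v)}"
  let ?S = "mk_symmetric (with_proj \<lparr>pverts = V, parcs = T\<rparr>)"
  let ?S' = "mk_symmetric (with_proj \<lparr>pverts = V, parcs = ?T'\<rparr>)"
  have T'_sub: "?T' \<subseteq> V \<times> V" using assms(2) by blast
  interpret S: pair_pre_digraph ?S .
  interpret S': pair_wf_digraph ?S'
    using T'_sub by unfold_locales (auto simp: parcs_mk_symmetric)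
  have V: "u \<in> V" "v \<in> V" using uv(1) assms(2) by auto
  have "reachable (with_proj ?S') v u"
    using linked_sym[OF uv(2)] reachable_sym_graph_iff[OF assms(1) T'_sub V(2)] by blast
  then obtain p where "S'.apath v p u"
    by (auto simp: S'.reachable_apath)
  then have p: "set p \<subseteq> ?T' \<union> ?T'\<inverse>" "pcas v p u" "distinct (pawalk_verts v p)"
    using parcs_sym_graph[OF assms(1) T'_sub] by (auto simp: S'.apath_def S'.awalk_def)
  have "u \<noteq> v" using uv(1) assms(4) by (auto simp: irrefl_def)
  moreover have "(v, u) \<notin> ?T' \<union> ?T'\<inverse>"
    using uv(1) assms(3) \<open>u \<noteq> v\<close> by (auto dest: antisymD)
  ultimately have "length p \<ge> 2"
    using p(1,2) by (cases p; cases "tl p") auto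
  moreover have "S.cycle ((u, v) # p)"
    unfolding S.cycle_def S.awalk_def
    using p uv(1) V parcs_sym_graph[OF assms(1,2)] by (auto intro!: exI[of _ u])
  ultimately show False
    using acyclic unfolding undirected_acyclic_def by force
qed

section \<open>The log-partition function\<close>

context
  fixes G :: "'v pair_pre_digraph" and X :: "'x set" and \<phi> :: "('v, 'x) potentials"
  assumes fin_verts: "finite (pverts G)" and fin_X: "finite X" and X_ne: "X \<noteq> {}"
    and wf: "parcs G \<subseteq> pverts G \<times> pverts G"
    and nonneg: "\<forall>e\<in>parcs G. \<forall>y\<in>X \<times> X. \<phi> e y \<ge> 0"
begin

abbreviation "energy \<theta> x \<equiv> \<Sum>e\<in>parcs G. \<theta> e * \<phi> e (x (fst e), x (snd e))"

lemma configs: "finite (pverts G \<rightarrow>\<^sub>E X)" "pverts G \<rightarrow>\<^sub>E X \<noteq> {}"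
  using fin_verts fin_X X_ne by (auto intro: finite_PiE simp: PiE_eq_empty_iff)

lemma partition_pos: "(\<Sum>x \<in> pverts G \<rightarrow>\<^sub>E X. exp (energy \<theta> x)) > 0"
  using configs by (intro sum_pos) auto

lemma potential_nonneg:
  assumes "x \<in> pverts G \<rightarrow>\<^sub>E X" "e \<in> parcs G"
  shows "\<phi> e (x (fst e), x (snd e)) \<ge> 0"
proof -
  have "fst e \<in> pverts G" "snd e \<in> pverts G"
    using assms(2) wf by auto
  then have "(x (fst e), x (snd e)) \<in> X \<times> X"
    using PiE_mem[OF assms(1)] by simp
  with nonneg assms(2) show ?thesis by blast
qed

lemma log_partition_mono:
  assumes "\<And>e. e \<in> parcs G \<Longrightarrow> \<theta> e \<le> \<eta> e"
  shows "log_partition G X \<phi> \<theta> \<le> log_partition G X \<phi> \<eta>"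
proof -
  have "energy \<theta> x \<le> energy \<eta> x" if "x \<in> pverts G \<rightarrow>\<^sub>E X" for x
    using assms potential_nonneg[OF that] by (intro sum_mono mult_right_mono) auto
  then have "(\<Sum>x \<in> pverts G \<rightarrow>\<^sub>E X. exp (energy \<theta> x)) \<le> (\<Sum>x \<in> pverts G \<rightarrow>\<^sub>E X. exp (energy \<eta> x))"
    by (intro sum_mono) simp
  then show ?thesis
    unfolding log_partition_def using partition_pos by (simp add: ln_mono)
qed

lemma log_partition_nonneg:
  assumes "\<And>e. e \<in> parcs G \<Longrightarrow> \<theta> e \<ge> 0"
  shows "log_partition G X \<phi> \<theta> \<ge> 0"
proof -
  have "card (pverts G \<rightarrow>\<^sub>E X) > 0"
    using configs by (simp add: card_gt_0_iff)
  then have "log_partition G X \<phi> (\<lambda>e. 0) \<ge> 0"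
    by (simp add: log_partition_def)
  also have "\<dots> \<le> log_partition G X \<phi> \<theta>"
    using assms by (rule log_partition_mono)
  finally show ?thesis .
qed

text \<open>The point is that \<open>p \<le> p powr c\<close> for a probability \<open>p\<close>, here the Gibbs weight of \<open>x\<close>.\<close>

lemma log_partition_scale:
  assumes "0 \<le> c" "c \<le> 1"
  shows "c * log_partition G X \<phi> \<theta> \<le> log_partition G X \<phi> (\<lambda>e. c * \<theta> e)"
proof -
  let ?A = "pverts G \<rightarrow>\<^sub>E X"
  define Z where "Z = (\<Sum>x\<in>?A. exp (energy \<theta> x))"
  have Z: "Z > 0" unfolding Z_def by (rule partition_pos)
  have "exp (energy \<theta> x) / Z \<le> exp (c * (energy \<theta> x - ln Z))" if "x \<in> ?A" for x
  proof -
    have "exp (energy \<theta> x) \<le> Z"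
      unfolding Z_def using configs(1) that by (intro member_le_sum) auto
    then have "energy \<theta> x \<le> ln Z"
      using Z by (simp add: ln_ge_iff)
    \<comment> \<open>The common factor is the logarithm of a probability, hence
      nonpositive.\<close>
    then have "1 * (energy \<theta> x - ln Z) \<le> c * (energy \<theta> x - ln Z)"
      using assms by (intro mult_right_mono_neg) auto
    then have "exp (energy \<theta> x - ln Z) \<le> exp (c * (energy \<theta> x - ln Z))"
      by simp
    then show ?thesis using Z by (simp add: exp_diff)
  qed
  then have "(\<Sum>x\<in>?A. exp (energy \<theta> x) / Z) \<le> (\<Sum>x\<in>?A. exp (c * (energy \<theta> x - ln Z)))"
    by (rule sum_mono)
  also have "(\<Sum>x\<in>?A. exp (energy \<theta> x) / Z) = 1"
    using Z by (simp add: Z_def flip: sum_divide_distrib)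
  also have "(\<Sum>x\<in>?A. exp (c * (energy \<theta> x - ln Z)))
      = (\<Sum>x\<in>?A. exp (energy (\<lambda>e. c * \<theta> e) x)) / exp (c * ln Z)"
    by (simp add: right_diff_distrib exp_diff sum_divide_distrib sum_distrib_left mult.assoc)
  finally have "exp (c * ln Z) \<le> (\<Sum>x\<in>?A. exp (energy (\<lambda>e. c * \<theta> e) x))"
    by (simp add: le_divide_eq)
  then have "c * ln Z \<le> ln (\<Sum>x\<in>?A. exp (energy (\<lambda>e. c * \<theta> e) x))"
    using partition_pos by (simp add: ln_ge_iff)
  then show ?thesis
    by (simp add: log_partition_def Z_def)
qed

text \<open>Hoelder's inequality, obtained by applying Jensen for \<open>exp\<close> to the
  logarithms of the normalised Gibbs weights at each x. Summed over x, the right side is 1, and the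
  left side is the mixed partition function divided by \<open>exp ?U\<close>.\<close>

lemma log_partition_convex:
  assumes "finite I" "\<And>i. i \<in> I \<Longrightarrow> p i \<ge> 0" "(\<Sum>i\<in>I. p i) = 1"
  shows "log_partition G X \<phi> (\<lambda>e. \<Sum>i\<in>I. p i * \<eta> i e) \<le> (\<Sum>i\<in>I. p i * log_partition G X \<phi> (\<eta> i))"
proof -
  let ?A = "pverts G \<rightarrow>\<^sub>E X"
  define Z where "Z i = (\<Sum>x\<in>?A. exp (energy (\<eta> i) x))" for i
  have Z: "Z i > 0" for i unfolding Z_def by (rule partition_pos)
  let ?U = "\<Sum>i\<in>I. p i * ln (Z i)"
  have I_ne: "I \<noteq> {}" using assms(3) by auto
  have energy_sum: "energy (\<lambda>e. \<Sum>i\<in>I. p i * \<eta> i e) x = (\<Sum>i\<in>I. p i * energy (\<eta> i) x)" for x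
    by (simp add: sum_distrib_left sum_distrib_right mult.assoc sum.swap[of _ I])
  have "exp (\<Sum>i\<in>I. p i * (energy (\<eta> i) x - ln (Z i)))
      \<le> (\<Sum>i\<in>I. p i * exp (energy (\<eta> i) x - ln (Z i)))" for x
    using convex_on_sum[OF assms(1) I_ne exp_convex assms(3), of "\<lambda>i. energy (\<eta> i) x - ln (Z i)"]
      assms(2) by simp
  then have "(\<Sum>x\<in>?A. exp (\<Sum>i\<in>I. p i * (energy (\<eta> i) x - ln (Z i))))
      \<le> (\<Sum>x\<in>?A. \<Sum>i\<in>I. p i * exp (energy (\<eta> i) x - ln (Z i)))"
    by (rule sum_mono)
  also have "\<dots> = (\<Sum>i\<in>I. p i * ((\<Sum>x\<in>?A. exp (energy (\<eta> i) x)) / Z i))"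
    using Z by (subst sum.swap) (simp add: exp_diff sum_distrib_left sum_divide_distrib)
  also have "\<dots> = 1"
    using Z assms(3) by (simp add: less_imp_neq[symmetric] flip: Z_def)
  also have "(\<Sum>x\<in>?A. exp (\<Sum>i\<in>I. p i * (energy (\<eta> i) x - ln (Z i))))
      = (\<Sum>x\<in>?A. exp (energy (\<lambda>e. \<Sum>i\<in>I. p i * \<eta> i e) x)) / exp ?U"
    by (simp only: energy_sum right_diff_distrib sum_subtractf exp_diff sum_divide_distrib)
  finally have "(\<Sum>x\<in>?A. exp (energy (\<lambda>e. \<Sum>i\<in>I. p i * \<eta> i e) x)) \<le> exp ?U"
    by (simp add: divide_le_eq)
  then have "ln (\<Sum>x\<in>?A. exp (energy (\<lambda>e. \<Sum>i\<in>I. p i * \<eta> i e) x)) \<le> ln (exp ?U)"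
    using partition_pos by (subst ln_le_cancel_iff) auto
  then show ?thesis
    by (simp add: log_partition_def Z_def)
qed

end

section \<open>Optimal tree distributions\<close>

lemma ex_pmf_with_finite_support:
  fixes p :: "'a \<Rightarrow> real"
  assumes "finite A" "\<And>x. p x \<ge> 0" "\<And>x. x \<notin> A \<Longrightarrow> p x = 0" "(\<Sum>x\<in>A. p x) = 1"
  obtains \<rho> where "pmf \<rho> = p" "set_pmf \<rho> \<subseteq> A"
proof -
  have "(\<integral>\<^sup>+x. ennreal (p x) \<partial>count_space UNIV) = (\<Sum>x\<in>A. ennreal (p x))"
    using assms(1,3) by (intro nn_integral_count_space') auto
  also have "\<dots> = 1"
    using assms(2,4) by (simp add: sum_ennreal)
  finally have "pmf (embed_pmf p) x = p x" for x
    using assms(2) by (intro pmf_embed_pmf) auto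
  then have "pmf (embed_pmf p) = p" ..
  moreover from this have "set_pmf (embed_pmf p) \<subseteq> A"
    using assms(3) by (metis set_pmf_iff subsetI)
  ultimately show thesis by (rule that)
qed

text \<open>Compactness is used in the space of mass functions, so f acts on functions rather than
  on \<open>pmf\<close> values.\<close>

lemma ex_max_pmf:
  fixes f :: "('a \<Rightarrow> real) \<Rightarrow> real"
  assumes "finite A" "A \<noteq> {}" "continuous_on UNIV f"
  obtains \<rho> where "set_pmf \<rho> \<subseteq> A" "\<And>\<sigma>. set_pmf \<sigma> \<subseteq> A \<Longrightarrow> f (pmf \<sigma>) \<le> f (pmf \<rho>)"
proof -
  \<comment> \<open>K consists of the mass functions supported in A. Fixing the coordinates off A to
    0 makes it a closed part of a product of compact sets, even over an infinite type.\<close>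
  define K where "K = PiE UNIV (\<lambda>x. if x \<in> A then {0..1::real} else {0}) \<inter> {p. (\<Sum>x\<in>A. p x) = 1}"
  have "compactin (product_topology (\<lambda>_. euclidean) UNIV)
      (PiE UNIV (\<lambda>x. if x \<in> A then {0..1::real} else {0}))"
    by (simp add: compactin_PiE)
  then have "compact (PiE UNIV (\<lambda>x. if x \<in> A then {0..1::real} else {0}))"
    by (simp add: euclidean_product_topology)
  moreover have "closed {p. (\<Sum>x\<in>A. p x) = (1::real)}"
    by (intro closed_Collect_eq continuous_intros continuous_on_product_coordinates)
  ultimately have "compact K"
    unfolding K_def by (rule compact_Int_closed)
  have pmf_K: "pmf \<sigma> \<in> K" if "set_pmf \<sigma> \<subseteq> A" for \<sigma>
    using that assms(1) sum_pmf_eq_1[of A \<sigma>]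
    by (auto simp: K_def PiE_iff pmf_le_1 pmf_eq_0_set_pmf subset_iff)
  obtain a where "a \<in> A" using assms(2) by blast
  then have "pmf (return_pmf a) \<in> K" by (intro pmf_K) simp
  then have "K \<noteq> {}" by blast
  with \<open>compact K\<close> obtain p where p: "p \<in> K" "\<And>q. q \<in> K \<Longrightarrow> f q \<le> f p"
    using continuous_attains_sup[of K f] continuous_on_subset[OF assms(3)] by auto
  have "p x \<ge> 0" "x \<notin> A \<Longrightarrow> p x = 0" for x
    using p(1) by (auto simp: K_def PiE_iff split: if_splits)
  moreover have "(\<Sum>x\<in>A. p x) = 1"
    using p(1) by (simp add: K_def)
  ultimately obtain \<rho> where "pmf \<rho> = p" "set_pmf \<rho> \<subseteq> A"
    using ex_pmf_with_finite_support[OF assms(1), of p] by blast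
  with p(2) pmf_K that show thesis by blast
qed

lemma continuous_on_Min:
  fixes f :: "'i \<Rightarrow> 'a::topological_space \<Rightarrow> real"
  assumes "finite I" "I \<noteq> {}" "\<And>i. i \<in> I \<Longrightarrow> continuous_on S (f i)"
  shows "continuous_on S (\<lambda>x. Min ((\<lambda>i. f i x) ` I))"
  using assms by (induction rule: finite_ne_induct) (auto intro!: continuous_intros)

section \<open>Spanning trees and edge probabilities of a fixed graph\<close>

locale connected_simple_graph =
  fixes G :: "'v pair_pre_digraph"
  assumes simple: "simple_graph G"
    and connected: "Digraph_Component.connected (with_proj G)"
    and arcs_ne: "parcs G \<noteq> {}"
begin

abbreviation "V \<equiv> pverts G"
abbreviation "E \<equiv> parcs G"

sublocale pair_digraph G
  using simple by (simp add: simple_graph_def)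

lemma E_sub: "E \<subseteq> V \<times> V"
  using wellformed' by auto

lemma irrefl_E: "irrefl E"
  using no_loops' by (auto simp: irrefl_def)

lemma antisym_E: "antisym E"
  using simple by (simp add: simple_graph_def)

lemma linked_E: "V \<times> V \<subseteq> linked E" and V_ne: "V \<noteq> {}"
proof -
  have "\<lparr>pverts = V, parcs = E\<rparr> = G"
    by (rule pair_pre_digraph.equality) simp_all
  with connected have "Digraph_Component.connected (with_proj \<lparr>pverts = V, parcs = E\<rparr>)"
    by (simp only:)
  then show "V \<times> V \<subseteq> linked E" "V \<noteq> {}"
    using connected_iff_linked[OF pair_finite_verts E_sub] by auto
qed

text \<open>This replaces walks by \<open>linked\<close> in all later arguments about trees; T
  inherits antisymmetry and irreflexivity from E.\<close>

lemma mem_spanning_trees_iff: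
  "T \<in> spanning_trees G \<longleftrightarrow> T \<subseteq> E \<and> V \<times> V \<subseteq> linked T \<and> all_bridges T"
proof (cases "T \<subseteq> E")
  case True
  then have T: "T \<subseteq> V \<times> V" "antisym T" "irrefl T"
    using E_sub antisym_E irrefl_E antisym_subset by (auto simp: irrefl_def)
  show ?thesis
    using True V_ne connected_iff_linked[OF pair_finite_verts T(1)]
      undirected_acyclic_if_all_bridges[OF pair_finite_verts T(1)]
      all_bridges_if_undirected_acyclic[OF pair_finite_verts T]
    by (auto simp: spanning_trees_def)
qed (simp add: spanning_trees_def)

lemma finite_spanning_trees: "finite (spanning_trees G)"
  using finite_subset[of "spanning_trees G" "Pow E"] pair_finite_arcs
  by (auto simp: spanning_trees_def)

lemma spanning_trees_ne: "spanning_trees G \<noteq> {}"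
proof -
  obtain T where "T \<subseteq> E" "V \<times> V \<subseteq> linked T" "\<And>e. e \<in> T \<Longrightarrow> \<not> V \<times> V \<subseteq> linked (T - {e})"
    using ex_minimal_linking[OF pair_finite_arcs linked_E] by blast
  moreover from this have "all_bridges T"
    by (intro all_bridges_minimal)
  ultimately show ?thesis
    using mem_spanning_trees_iff by blast
qed

text \<open>\<open>dist_kappa\<close> is a minimum of finitely many linear functions of the mass
  function, hence continuous.\<close>

lemma ex_optimal_tree_dist: "optimal_tree_dists G \<noteq> {}"
proof -
  let ?f = "\<lambda>p :: _ \<Rightarrow> real. Min ((\<lambda>e. \<Sum>T\<in>spanning_trees G. p T * of_bool (e \<in> T)) ` E)"
  have "continuous_on UNIV ?f"
    by (rule continuous_on_Min[OF pair_finite_arcs arcs_ne])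
      (intro continuous_intros continuous_on_product_coordinates)
  then obtain \<rho> where "set_pmf \<rho> \<subseteq> spanning_trees G"
      "\<And>\<sigma>. set_pmf \<sigma> \<subseteq> spanning_trees G \<Longrightarrow> ?f (pmf \<sigma>) \<le> ?f (pmf \<rho>)"
    using ex_max_pmf[OF finite_spanning_trees spanning_trees_ne] by blast
  moreover have "dist_kappa G \<sigma> = ?f (pmf \<sigma>)" for \<sigma>
    by (simp add: dist_kappa_def edge_prob_def)
  ultimately have "\<rho> \<in> optimal_tree_dists G"
    by (auto simp: optimal_tree_dists_def is_arg_max_linorder tree_dists_def)
  then show ?thesis by blast
qed

lemma dist_kappa_le_edge_prob: "e \<in> E \<Longrightarrow> dist_kappa G \<rho> \<le> edge_prob G \<rho> e"
  unfolding dist_kappa_def using pair_finite_arcs by (intro Min_le) auto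

lemma edge_prob_le_1:
  assumes "\<rho> \<in> tree_dists G"
  shows "edge_prob G \<rho> e \<le> 1"
proof -
  have "edge_prob G \<rho> e \<le> (\<Sum>T\<in>spanning_trees G. pmf \<rho> T)"
    unfolding edge_prob_def by (intro sum_mono) auto
  also have "\<dots> = 1"
    using assms finite_spanning_trees by (simp add: tree_dists_def sum_pmf_eq_1)
  finally show ?thesis .
qed

lemma graph_kappa_le:
  assumes "S \<subseteq> V" "edges_within G S \<noteq> {}"
  shows "graph_kappa G * card (edges_within G S) \<le> real (card S) - 1"
proof -
  have "finite (edges_within G S)"
    using pair_finite_arcs by (simp add: edges_within_def)
  with assms(2) have "card (edges_within G S) > 0"
    by (simp add: card_gt_0_iff)
  moreover have "graph_kappa G \<le> (real (card S) - 1) / card (edges_within G S)"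
    unfolding graph_kappa_def using assms pair_finite_verts by (intro Min_le) auto
  ultimately show ?thesis by (simp add: le_divide_eq)
qed

text \<open>A set containing an edge contains its two distinct endpoints, so every numerator is at
  least 1.\<close>

lemma graph_kappa_pos: "graph_kappa G > 0"
proof -
  have "edges_within G V \<noteq> {}"
    using arcs_ne E_sub by (auto simp: edges_within_def)
  moreover have "(real (card S) - 1) / card (edges_within G S) > 0"
    if S: "S \<subseteq> V" "edges_within G S \<noteq> {}" for S
  proof -
    obtain u v where uv: "(u, v) \<in> E" "u \<in> S" "v \<in> S"
      using S(2) by (auto simp: edges_within_def)
    have "finite S" using S(1) pair_finite_verts by (rule finite_subset)
    then have "card {u, v} \<le> card S"
      using uv by (intro card_mono) auto
    moreover have "card {u, v} = 2"
      using no_loops'[OF uv(1)] by simp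
    moreover have "card (edges_within G S) > 0"
      using S(2) pair_finite_arcs by (simp add: card_gt_0_iff edges_within_def)
    ultimately show ?thesis by simp
  qed
  ultimately show ?thesis
    unfolding graph_kappa_def using pair_finite_verts by (subst Min_gr_iff) auto
qed

lemma tree_dist_exchange:
  assumes \<rho>: "\<rho> \<in> tree_dists G" and T: "T \<in> spanning_trees G"
    and T': "insert f (T - {e}) \<in> spanning_trees G" and "e \<in> T" "f \<notin> T"
    and \<epsilon>: "0 \<le> \<epsilon>" "\<epsilon> \<le> pmf \<rho> T"
  obtains \<sigma> where "\<sigma> \<in> tree_dists G"
    "\<And>g. edge_prob G \<sigma> g = edge_prob G \<rho> g + \<epsilon> * of_bool (g = f) - \<epsilon> * of_bool (g = e)"
proof -
  let ?T' = "insert f (T - {e})"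
  let ?A = "spanning_trees G"
  define p where "p U = pmf \<rho> U + \<epsilon> * of_bool (U = ?T') - \<epsilon> * of_bool (U = T)" for U
  \<comment> \<open>Taking h constant 1 gives the total mass, and h the indicator of containing g
    gives the edge probabilities.\<close>
  have sum_p: "(\<Sum>U\<in>?A. p U * h U) = (\<Sum>U\<in>?A. pmf \<rho> U * h U) + \<epsilon> * h ?T' - \<epsilon> * h T"
    for h :: "('v \<times> 'v) set \<Rightarrow> real"
  proof -
    have "(\<Sum>U\<in>?A. p U * h U) = (\<Sum>U\<in>?A. pmf \<rho> U * h U)
        + (\<Sum>U\<in>?A. \<epsilon> * of_bool (U = ?T') * h U) - (\<Sum>U\<in>?A. \<epsilon> * of_bool (U = T) * h U)"
      by (simp add: p_def algebra_simps sum.distrib sum_subtractf)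
    also have "(\<Sum>U\<in>?A. \<epsilon> * of_bool (U = ?T') * h U) = \<epsilon> * h ?T'"
      using T' finite_spanning_trees by (subst sum.remove[of _ ?T']) auto
    also have "(\<Sum>U\<in>?A. \<epsilon> * of_bool (U = T) * h U) = \<epsilon> * h T"
      using T finite_spanning_trees by (subst sum.remove[of _ T]) auto
    finally show ?thesis .
  qed
  have "p U \<ge> 0" for U
    using \<epsilon> by (auto simp: p_def)
  moreover have "p U = 0" if "U \<notin> ?A" for U
    using that T T' \<rho> by (auto simp: p_def tree_dists_def pmf_eq_0_set_pmf)
  moreover have "(\<Sum>U\<in>?A. p U) = 1"
    using sum_p[of "\<lambda>_. 1"] \<rho> finite_spanning_trees by (simp add: tree_dists_def sum_pmf_eq_1)
  ultimately obtain \<sigma> where \<sigma>: "pmf \<sigma> = p" "set_pmf \<sigma> \<subseteq> ?A"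
    using ex_pmf_with_finite_support[OF finite_spanning_trees, of p] by blast
  have "edge_prob G \<sigma> g = edge_prob G \<rho> g + \<epsilon> * of_bool (g = f) - \<epsilon> * of_bool (g = e)" for g
    using sum_p[of "\<lambda>U. of_bool (g \<in> U)"] assms(4,5) by (auto simp: edge_prob_def \<sigma>(1))
  with \<sigma>(2) that show thesis by (auto simp: tree_dists_def)
qed

definition tight_edges where
  "tight_edges \<rho> = {e \<in> E. edge_prob G \<rho> e = dist_kappa G \<rho>}"

text \<open>Otherwise, exchanging a non-tight edge of a tree for a tight one either increases the
  minimal edge probability or makes fewer edges tight.\<close>

lemma tight_edges_linked:
  assumes opt: "\<rho> \<in> optimal_tree_dists G"
    and least: "\<And>\<sigma>. \<sigma> \<in> optimal_tree_dists G \<Longrightarrow> card (tight_edges \<rho>) \<le> card (tight_edges \<sigma>)"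
    and T: "T \<in> set_pmf \<rho>"
  shows "tight_edges \<rho> \<subseteq> linked (T \<inter> tight_edges \<rho>)"
proof clarify
  fix a b assume f: "(a, b) \<in> tight_edges \<rho>"
  let ?m = "dist_kappa G \<rho>"
  have \<rho>: "\<rho> \<in> tree_dists G" and max: "\<And>\<sigma>. \<sigma> \<in> tree_dists G \<Longrightarrow> dist_kappa G \<sigma> \<le> ?m"
    using opt by (auto simp: optimal_tree_dists_def is_arg_max_linorder)
  have tree: "T \<in> spanning_trees G"
    using T \<rho> by (auto simp: tree_dists_def)
  then have T_props: "T \<subseteq> E" "V \<times> V \<subseteq> linked T" "all_bridges T"
    by (auto simp: mem_spanning_trees_iff)
  have ab: "(a, b) \<in> E" "(a, b) \<in> linked T"
    using f E_sub T_props(2) by (auto simp: tight_edges_def)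
  show "(a, b) \<in> linked (T \<inter> tight_edges \<rho>)"
  proof (rule ccontr)
    assume not_linked: "(a, b) \<notin> linked (T \<inter> tight_edges \<rho>)"
    then have "(a, b) \<notin> T"
      using f subset_linked by blast
    obtain e where e: "e \<in> T - tight_edges \<rho>" "(a, b) \<notin> linked (T - {e})"
      using ex_cut_edge[OF finite_subset[OF T_props(1) pair_finite_arcs] T_props(3) ab(2) not_linked]
      by blast
    have "e \<in> T" using e(1) by blast
    with \<open>(a, b) \<notin> T\<close> have "e \<noteq> (a, b)" by blast
    have "insert (a, b) (T - {e}) \<in> spanning_trees G"
      unfolding mem_spanning_trees_iff linked_exchange[OF \<open>e \<in> T\<close> ab(2) e(2)]
      using all_bridges_exchange[OF T_props(3) \<open>e \<in> T\<close> e(2)] T_props(1,2) ab(1) by blast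
    \<comment> \<open>The first bound keeps the mass of T nonnegative; half of the slack of e keeps
      e strictly above the minimum.\<close>
    moreover define \<epsilon> where "\<epsilon> = min (pmf \<rho> T) ((edge_prob G \<rho> e - ?m) / 2)"
    have "edge_prob G \<rho> e > ?m"
    proof -
      have "e \<in> E" using \<open>e \<in> T\<close> T_props(1) by blast
      moreover from this have "edge_prob G \<rho> e \<noteq> ?m" using e(1) by (simp add: tight_edges_def)
      ultimately show ?thesis using dist_kappa_le_edge_prob[of e \<rho>] by simp
    qed
    then have \<epsilon>: "\<epsilon> > 0" "\<epsilon> \<le> pmf \<rho> T" "edge_prob G \<rho> e - \<epsilon> > ?m"
      using T by (auto simp: \<epsilon>_def pmf_positive min_def field_simps)
    ultimately obtain \<sigma> where \<sigma>: "\<sigma> \<in> tree_dists G"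
      "\<And>g. edge_prob G \<sigma> g = edge_prob G \<rho> g + \<epsilon> * of_bool (g = (a, b)) - \<epsilon> * of_bool (g = e)"
      using tree_dist_exchange[OF \<rho> tree _ \<open>e \<in> T\<close> \<open>(a, b) \<notin> T\<close>, of \<epsilon>] less_imp_le[OF \<epsilon>(1)] \<epsilon>(2) by blast
    have ge: "edge_prob G \<sigma> g \<ge> ?m" if "g \<in> E" for g
      unfolding \<sigma>(2) using \<epsilon>(1,3) dist_kappa_le_edge_prob[OF that, of \<rho>]
      by (cases "g = e"; cases "g = (a, b)") simp_all
    then have "dist_kappa G \<sigma> \<ge> ?m"
      unfolding dist_kappa_def[of G \<sigma>] using arcs_ne pair_finite_arcs by (subst Min_ge_iff) auto
    with max[OF \<sigma>(1)] have kappa_eq: "dist_kappa G \<sigma> = ?m" by simp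
    then have "\<sigma> \<in> optimal_tree_dists G"
      using \<sigma>(1) max by (auto simp: optimal_tree_dists_def is_arg_max_linorder)
    then have "card (tight_edges \<rho>) \<le> card (tight_edges \<sigma>)" by (rule least)
    \<comment> \<open>Only two probabilities change: e stays above the minimum, so no tight edge is
      added, and (a, b) rises above it, so one is lost.\<close>
    moreover have "tight_edges \<sigma> \<subset> tight_edges \<rho>"
    proof
      show "tight_edges \<sigma> \<subseteq> tight_edges \<rho>"
      proof
        fix g assume g: "g \<in> tight_edges \<sigma>"
        then have "g \<in> E" "edge_prob G \<sigma> g = ?m"
          by (auto simp: tight_edges_def kappa_eq)
        moreover from this have "g \<noteq> e"
          using \<epsilon>(3) \<open>e \<noteq> (a, b)\<close> by (auto simp: \<sigma>(2))
        moreover have "g \<noteq> (a, b)"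
          using calculation f \<epsilon>(1) by (auto simp: \<sigma>(2) tight_edges_def)
        ultimately show "g \<in> tight_edges \<rho>"
          by (simp add: \<sigma>(2) tight_edges_def)
      qed
      have "(a, b) \<notin> tight_edges \<sigma>"
        using f \<epsilon>(1) \<open>e \<noteq> (a, b)\<close> by (auto simp: tight_edges_def kappa_eq \<sigma>(2))
      with f show "tight_edges \<sigma> \<noteq> tight_edges \<rho>" by blast
    qed
    moreover have "finite (tight_edges \<rho>)"
      using pair_finite_arcs by (simp add: tight_edges_def)
    ultimately show False
      using psubset_card_mono[of "tight_edges \<rho>" "tight_edges \<sigma>"] by simp
  qed
qed

lemma graph_kappa_le_dist_kappa:
  assumes "\<rho> \<in> optimal_tree_dists G"
  shows "graph_kappa G \<le> dist_kappa G \<rho>"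
proof -
  \<comment> \<open>The exchange argument applies to an optimal distribution with fewest tight
    edges; the bound carries over because all optimal distributions share the same
    \<open>dist_kappa\<close>.\<close>
  obtain \<sigma> where \<sigma>: "\<sigma> \<in> optimal_tree_dists G"
    and least: "\<And>\<tau>. \<tau> \<in> optimal_tree_dists G \<Longrightarrow> card (tight_edges \<sigma>) \<le> card (tight_edges \<tau>)"
    using ex_has_least_nat[of "\<lambda>\<tau>. \<tau> \<in> optimal_tree_dists G" \<rho> "card \<circ> tight_edges"] assms by auto
  have \<sigma>_dist: "\<sigma> \<in> tree_dists G" and eq: "dist_kappa G \<rho> = dist_kappa G \<sigma>"
    using assms \<sigma> by (auto simp: optimal_tree_dists_def is_arg_max_linorder intro: antisym)
  define M where "M = tight_edges \<sigma>"
  have M_sub: "M \<subseteq> E" and fin_M: "finite M"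
    using pair_finite_arcs by (auto simp: M_def tight_edges_def)
  have "M \<noteq> {}"
  proof -
    have "dist_kappa G \<sigma> \<in> edge_prob G \<sigma> ` E"
      unfolding dist_kappa_def using pair_finite_arcs arcs_ne by (intro Min_in) auto
    then obtain e where "e \<in> E" "dist_kappa G \<sigma> = edge_prob G \<sigma> e" by blast
    then have "e \<in> M" by (simp add: M_def tight_edges_def)
    then show ?thesis by blast
  qed
  have sparse: "graph_kappa G * card (M \<inter> S \<times> S) \<le> real (card S) - 1" if S: "S \<subseteq> V" "S \<noteq> {}" for S
  \<comment> \<open>Sets without edges do not enter \<open>graph_kappa\<close>; for them the claim
    is just that S is nonempty.\<close>
  proof (cases "edges_within G S = {}")
    case True
    then have "M \<inter> S \<times> S = {}" using M_sub by (auto simp: edges_within_def)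
    moreover have "card S > 0"
      using S pair_finite_verts by (simp add: card_gt_0_iff finite_subset)
    ultimately show ?thesis by simp
  next
    case False
    have "card (M \<inter> S \<times> S) \<le> card (edges_within G S)"
      using M_sub pair_finite_arcs by (intro card_mono) (auto simp: edges_within_def)
    then have "graph_kappa G * card (M \<inter> S \<times> S) \<le> graph_kappa G * card (edges_within G S)"
      using graph_kappa_pos by (intro mult_left_mono) auto
    also have "\<dots> \<le> real (card S) - 1"
      using graph_kappa_le[OF S(1) False] .
    finally show ?thesis .
  qed
  have tree_ge: "graph_kappa G * card M \<le> card (T \<inter> M)" if "T \<in> set_pmf \<sigma>" for T
    using tight_edges_linked[OF \<sigma> least that] M_sub E_sub
    by (intro card_linking_set_ge[OF pair_finite_verts _ _ _ sparse]) (auto simp: M_def)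
  have "graph_kappa G * card M = (\<Sum>T\<in>spanning_trees G. pmf \<sigma> T * (graph_kappa G * card M))"
    using \<sigma>_dist finite_spanning_trees
    by (simp add: tree_dists_def sum_pmf_eq_1 flip: sum_distrib_right)
  also have "\<dots> \<le> (\<Sum>T\<in>spanning_trees G. pmf \<sigma> T * card (T \<inter> M))"
  proof (rule sum_mono)
    fix T
    show "pmf \<sigma> T * (graph_kappa G * card M) \<le> pmf \<sigma> T * card (T \<inter> M)"
      using tree_ge[of T] by (cases "pmf \<sigma> T = 0") (auto simp: mult_left_mono set_pmf_iff)
  qed
  \<comment> \<open>Double counting: the expected number of tight edges in a random tree is the sum
    of their probabilities.\<close>
  also have "\<dots> = (\<Sum>T\<in>spanning_trees G. \<Sum>e\<in>M. pmf \<sigma> T * of_bool (e \<in> T))"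
    using fin_M by (intro sum.cong refl) (simp add: Int_commute flip: sum_distrib_left)
  also have "\<dots> = (\<Sum>e\<in>M. edge_prob G \<sigma> e)"
    by (subst sum.swap) (simp add: edge_prob_def)
  also have "\<dots> = dist_kappa G \<sigma> * card M"
    by (simp add: M_def tight_edges_def)
  finally show ?thesis
    using \<open>M \<noteq> {}\<close> fin_M by (simp add: eq card_gt_0_iff)
qed

section \<open>The approximation ratio\<close>

context
  fixes X :: "'x set" and \<phi> :: "('v, 'x) potentials" and \<theta> :: "'v weights" and \<rho>
  assumes inst: "(X, \<phi>, \<theta>) \<in> model_instances G" and \<rho>: "\<rho> \<in> optimal_tree_dists G"
begin

lemma inst_props:
  "finite X" "X \<noteq> {}" "\<forall>e\<in>E. \<forall>y\<in>X \<times> X. \<phi> e y \<ge> 0" "\<And>e. e \<in> E \<Longrightarrow> \<theta> e \<ge> 0"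
  using inst by (auto simp: model_instances_def)

lemmas lp_mono = log_partition_mono[OF pair_finite_verts inst_props(1,2) E_sub inst_props(3)]
lemmas lp_nonneg = log_partition_nonneg[OF pair_finite_verts inst_props(1,2) E_sub inst_props(3)]
lemmas lp_scale = log_partition_scale[OF pair_finite_verts inst_props(1,2) E_sub inst_props(3)]
lemmas lp_convex = log_partition_convex[OF pair_finite_verts inst_props(1,2) E_sub inst_props(3)]

lemma tree_dist: "\<rho> \<in> tree_dists G"
  using \<rho> by (simp add: optimal_tree_dists_def is_arg_max_def)

lemma sum_pmf_trees: "(\<Sum>T\<in>spanning_trees G. pmf \<rho> T) = 1"
  using tree_dist finite_spanning_trees by (simp add: tree_dists_def sum_pmf_eq_1)

lemma dist_kappa_bounds: "0 < dist_kappa G \<rho>" "dist_kappa G \<rho> \<le> 1"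
proof -
  show "0 < dist_kappa G \<rho>"
    using graph_kappa_pos graph_kappa_le_dist_kappa[OF \<rho>] by simp
  obtain e where "e \<in> E" using arcs_ne by blast
  then show "dist_kappa G \<rho> \<le> 1"
    using dist_kappa_le_edge_prob[of e \<rho>] edge_prob_le_1[OF tree_dist, of e] by simp
qed

lemma edge_prob_pos: "e \<in> E \<Longrightarrow> edge_prob G \<rho> e > 0"
  using dist_kappa_bounds(1) dist_kappa_le_edge_prob by (rule less_le_trans)

text \<open>Setting nonnegative weights off a tree to 0 can only decrease the log-partition
  function.\<close>

lemma trw_lower_le: "trw_lower \<rho> G X \<phi> \<theta> \<le> log_partition G X \<phi> \<theta>"
proof -
  have "trw_lower \<rho> G X \<phi> \<theta> \<le> (\<Sum>T\<in>spanning_trees G. pmf \<rho> T * log_partition G X \<phi> \<theta>)"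
    unfolding trw_lower_def
    by (intro sum_mono mult_left_mono lp_mono) (auto simp: tree_weights_def inst_props(4))
  then show ?thesis
    by (simp add: sum_pmf_trees flip: sum_distrib_right)
qed

text \<open>Division by the edge probabilities makes the tree weights average to the original
  weights, so convexity applies.\<close>

lemma trw_upper_ge: "log_partition G X \<phi> \<theta> \<le> trw_upper \<rho> G X \<phi> \<theta>"
proof -
  let ?\<eta> = "\<lambda>T. scaled_tree_weights G \<rho> T \<theta>"
  have "(\<Sum>T\<in>spanning_trees G. pmf \<rho> T * ?\<eta> T e) = \<theta> e" if "e \<in> E" for e
  proof -
    have "(\<Sum>T\<in>spanning_trees G. pmf \<rho> T * ?\<eta> T e) = edge_prob G \<rho> e * (\<theta> e / edge_prob G \<rho> e)"
      unfolding edge_prob_def[of G \<rho> e] sum_distrib_right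
      by (simp add: scaled_tree_weights_def edge_prob_def mult.assoc)
    then show ?thesis using edge_prob_pos[OF that] by simp
  qed
  then have "log_partition G X \<phi> \<theta>
      \<le> log_partition G X \<phi> (\<lambda>e. \<Sum>T\<in>spanning_trees G. pmf \<rho> T * ?\<eta> T e)"
    by (intro lp_mono) auto
  also have "\<dots> \<le> trw_upper \<rho> G X \<phi> \<theta>"
    unfolding trw_upper_def by (rule lp_convex) (auto simp: finite_spanning_trees sum_pmf_trees)
  finally show ?thesis .
qed

text \<open>Tree by tree: \<open>lp_scale\<close> moves the factor into the weights, and since it is
  at most every edge probability, the shrunken scaled weights lie below the plain tree
  weights.\<close>

lemma trw_lower_ge: "dist_kappa G \<rho> * trw_upper \<rho> G X \<phi> \<theta> \<le> trw_lower \<rho> G X \<phi> \<theta>"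
proof -
  let ?m = "dist_kappa G \<rho>"
  have "?m * log_partition G X \<phi> (scaled_tree_weights G \<rho> T \<theta>)
      \<le> log_partition G X \<phi> (tree_weights T \<theta>)" for T
  proof -
    have "?m * scaled_tree_weights G \<rho> T \<theta> e \<le> tree_weights T \<theta> e" if "e \<in> E" for e
    proof -
      have "?m * \<theta> e \<le> edge_prob G \<rho> e * \<theta> e"
        using dist_kappa_le_edge_prob[OF that] inst_props(4)[OF that] by (rule mult_right_mono)
      then show ?thesis
        using edge_prob_pos[OF that]
        by (simp add: scaled_tree_weights_def tree_weights_def divide_le_eq mult.commute)
    qed
    then have "log_partition G X \<phi> (\<lambda>e. ?m * scaled_tree_weights G \<rho> T \<theta> e)
        \<le> log_partition G X \<phi> (tree_weights T \<theta>)"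
      by (rule lp_mono)
    with lp_scale[of ?m "scaled_tree_weights G \<rho> T \<theta>"] dist_kappa_bounds show ?thesis by simp
  qed
  then have "pmf \<rho> T * (?m * log_partition G X \<phi> (scaled_tree_weights G \<rho> T \<theta>))
      \<le> pmf \<rho> T * log_partition G X \<phi> (tree_weights T \<theta>)" for T
    by (intro mult_left_mono) auto
  then have "(\<Sum>T\<in>spanning_trees G. pmf \<rho> T * (?m * log_partition G X \<phi> (scaled_tree_weights G \<rho> T \<theta>)))
      \<le> trw_lower \<rho> G X \<phi> \<theta>"
    unfolding trw_lower_def by (rule sum_mono)
  then show ?thesis
    by (simp add: trw_upper_def sum_distrib_left mult.left_commute)
qed

text \<open>With k, F, L, U as in the proof, k F <= L and F <= U give k F^2 <= L U, while L <= F and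
  k U <= L give k L U <= F^2. The product form also covers F = 0.\<close>

lemma trw_estimate_bounds:
  "sqrt (graph_kappa G) * log_partition G X \<phi> \<theta> \<le> trw_estimate \<rho> G X \<phi> \<theta>"
  "sqrt (graph_kappa G) * trw_estimate \<rho> G X \<phi> \<theta> \<le> log_partition G X \<phi> \<theta>"
proof -
  let ?k = "graph_kappa G" and ?F = "log_partition G X \<phi> \<theta>"
  let ?L = "trw_lower \<rho> G X \<phi> \<theta>" and ?U = "trw_upper \<rho> G X \<phi> \<theta>"
  have k: "?k > 0" by (rule graph_kappa_pos)
  have F: "0 \<le> ?F" by (rule lp_nonneg) (rule inst_props(4))
  note U = trw_upper_ge and L = trw_lower_le
  have "?k * ?U \<le> dist_kappa G \<rho> * ?U"
    using graph_kappa_le_dist_kappa[OF \<rho>] F U by (intro mult_right_mono) auto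
  with trw_lower_ge have kU: "?k * ?U \<le> ?L" by simp
  have "?k * ?F \<le> ?k * ?U" using k U by simp
  with kU have kF: "?k * ?F \<le> ?L" by simp
  moreover have "0 \<le> ?k * ?F" using k F by simp
  ultimately have L0: "0 \<le> ?L" by simp
  have "?k * ?F * ?F \<le> ?L * ?U"
    using kF U F L0 by (intro mult_mono)
  then have "sqrt (?k * ?F * ?F) \<le> sqrt (?L * ?U)" by (rule real_sqrt_le_mono)
  then show "sqrt ?k * ?F \<le> trw_estimate \<rho> G X \<phi> \<theta>"
    using F by (simp add: trw_estimate_def real_sqrt_mult mult.assoc)
  have "?L * (?k * ?U) \<le> ?F * ?F"
    using L kU L F L0 U k by (intro mult_mono) auto
  then have "?k * (?L * ?U) \<le> ?F * ?F" by (simp add: mult.left_commute)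
  then have "sqrt (?k * (?L * ?U)) \<le> sqrt (?F * ?F)" by (rule real_sqrt_le_mono)
  then show "sqrt ?k * trw_estimate \<rho> G X \<phi> \<theta> \<le> ?F"
    using F by (simp add: trw_estimate_def real_sqrt_mult)
qed

end

text \<open>The two endpoints of a single edge serve as S. The claimed ratio bound is therefore at
  least 1, as the exact estimate of 0 requires.\<close>

lemma graph_kappa_le_1: "graph_kappa G \<le> 1"
proof -
  obtain u v where uv: "(u, v) \<in> E" using arcs_ne by auto
  then have "u \<in> V" "v \<in> V" "u \<noteq> v" using E_sub no_loops' by auto
  moreover have "edges_within G {u, v} \<noteq> {}" using uv by (auto simp: edges_within_def)
  moreover from this have "card (edges_within G {u, v}) \<ge> 1"
    using pair_finite_arcs by (simp add: edges_within_def Suc_le_eq card_gt_0_iff)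
  ultimately have "graph_kappa G * card (edges_within G {u, v}) \<le> 1"
    "graph_kappa G * 1 \<le> graph_kappa G * card (edges_within G {u, v})"
    using graph_kappa_le[of "{u, v}"] graph_kappa_pos by (auto intro!: mult_left_mono)
  then show ?thesis by simp
qed

end

text \<open>If b = 0, then c > 0 forces a = 0, and the ratio is 1 by convention;
  \<open>c \<le> 1\<close> covers this case.\<close>

lemma ratio_le:
  assumes "0 < c" "c \<le> 1" "0 \<le> a" "0 \<le> b" "c * a \<le> b"
  shows "ratio a b \<le> ereal (1 / c)"
proof (cases "b = 0")
  case True
  with assms have "a = 0" by (simp add: mult_le_0_iff)
  with True assms show ?thesis by (simp add: ratio_def one_ereal_def)
next
  case False
  with assms have "a / b \<le> 1 / c" by (simp add: field_simps)
  with False show ?thesis by (simp add: ratio_def)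
qed

theorem theorem1:
  fixes G :: "nat pair_pre_digraph" and N :: nat
  assumes "simple_graph G" and "pverts G = {1..N}"
    and "Digraph_Component.connected (with_proj G)"
    and "parcs G \<noteq> {}"
  shows "optimal_tree_dists G \<noteq> {} \<and>
         (\<forall>\<rho>\<in>optimal_tree_dists G.
            approx_ratio G (trw_estimate \<rho> :: (nat, 'x) estimator)
              \<le> ereal (1 / sqrt (graph_kappa G)))"
proof (intro conjI ballI)
  interpret connected_simple_graph G
    using assms(1,3,4) by unfold_locales
  show "optimal_tree_dists G \<noteq> {}" by (rule ex_optimal_tree_dist)
  fix \<rho> assume \<rho>: "\<rho> \<in> optimal_tree_dists G"
  have "max (ratio (log_partition G X \<phi> \<theta>) (trw_estimate \<rho> G X \<phi> \<theta>))
      (ratio (trw_estimate \<rho> G X \<phi> \<theta>) (log_partition G X \<phi> \<theta>)) \<le> ereal (1 / sqrt (graph_kappa G))"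
    if inst: "(X, \<phi>, \<theta>) \<in> model_instances G" for X :: "'x set" and \<phi> \<theta>
  proof -
    note bounds = trw_estimate_bounds[OF inst \<rho>]
    have F: "0 \<le> log_partition G X \<phi> \<theta>"
      using lp_nonneg[OF inst \<rho>] inst_props(4)[OF inst \<rho>] by blast
    then have "0 \<le> sqrt (graph_kappa G) * log_partition G X \<phi> \<theta>"
      using graph_kappa_pos by simp
    with bounds(1) have "0 \<le> trw_estimate \<rho> G X \<phi> \<theta>" by linarith
    \<comment> \<open>\<open>ratio_le\<close> is applied to both quotients with c the square root of
      \<open>graph_kappa G\<close>.\<close>
    with F bounds show ?thesis
      using graph_kappa_pos graph_kappa_le_1 by (intro max.boundedI ratio_le) auto
  qed
  then show "approx_ratio G (trw_estimate \<rho> :: (nat, 'x) estimator)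
      \<le> ereal (1 / sqrt (graph_kappa G))"
    unfolding approx_ratio_def by (intro SUP_least) auto
qed

end
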